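(* Assume Conjecture B (stated in the context). Let $c_0$ be the solution in $(0,1)$ of $2\log c+\log(c+1)+c\log(1+1/c)=1$ (natural logarithm; $c_0\approx0.865722$). Then for every $c>c_0$ there is $b_0$ such that for every prime number $b\ge b_0$ and every positive integer $t\ge cb$, the sequence of iterates $(S_{t,b}^k(n))_{k\ge1}$ diverges for every sufficiently large integer $n$.
   Context: For integers $t\ge 0$, $b\ge 2$, the $t$-shifted Sloane map in base $b$ is $S_{t,b}(n)=\prod_{i=0}^k (d_i+t)$, where $n=\sum_{i=0}^k d_ib^i$ is the base-$b$ expansion of $n$ ($0\le d_i\le b-1$, $d_k>0$); $S_{t,b}^k$ is its $k$-th iterate. For a base $q$, a digit $d$ and a positive integer $n$, $\#d(n)_q$ is the number of occurrences of $d$ in the base-$q$ expansion of $n$ and $\#(n)_q$ the number of base-$q$ digits of $n$. Given $\varepsilon>0$, $n$ is $\varepsilon$-equidistributed in base $q$ if $\left|\frac{\#d(n)_q}{\#(n)_q}-\frac1q\right|<\varepsilon$ for every $d\in\{0,\dots,q-1\}$. Conjecture B: For every integer $q>1$, every finite set $F=\{p_1,\dots,p_k\}$ of primes that does not contain all primes dividing $q$, and every positive integer $a$, for every $\varepsilon>0$ there exists $N$ such that $a\prod_{i=1}^k p_i^{\alpha_i}$ (nonnegative integers $\alpha_i$) is $\varepsilon$-equidistributed in base $q$ whenever $\alpha_i\ge N$ for some $i$. *)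

theory Defs
  imports Complex_Main "HOL-Computational_Algebra.Primes"
begin

text \<open>Base-\<open>b\<close> digits, least significant first. The number \<open>0\<close> has the single digit \<open>0\<close>.
  The guard \<open>b < 2\<close> only serves termination.\<close>

fun digits :: "nat \<Rightarrow> nat \<Rightarrow> nat list" where
  "digits b n = (if b < 2 \<or> n < b then [n] else (n mod b) # digits b (n div b))"

declare digits.simps [simp del]

definition sloane :: "nat \<Rightarrow> nat \<Rightarrow> nat \<Rightarrow> nat" where
  "sloane t b n = (\<Prod>d\<leftarrow>digits b n. d + t)"

definition equidistributed :: "real \<Rightarrow> nat \<Rightarrow> nat \<Rightarrow> bool" where
  "equidistributed \<epsilon> q n \<longleftrightarrow>
     (\<forall>d<q. \<bar>real (count_list (digits q n) d) / real (length (digits q n)) - 1 / real q\<bar> < \<epsilon>)"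

definition conjecture_B :: bool where
  "conjecture_B \<longleftrightarrow>
     (\<forall>q::nat. \<forall>F::nat set. \<forall>a::nat. \<forall>\<epsilon>::real.
        q > 1 \<and> finite F \<and> (\<forall>p\<in>F. prime p) \<and> \<not> {p. prime p \<and> p dvd q} \<subseteq> F \<and> a > 0 \<and> \<epsilon> > 0 \<longrightarrow>
        (\<exists>N::nat. \<forall>\<alpha>::nat \<Rightarrow> nat. (\<exists>p\<in>F. \<alpha> p \<ge> N) \<longrightarrow>
           equidistributed \<epsilon> q (a * (\<Prod>p\<in>F. p ^ \<alpha> p))))"

definition c0 :: real where
  "c0 = (THE c. 0 < c \<and> c < 1 \<and> 2 * ln c + ln (c + 1) + c * ln (1 + 1 / c) = 1)"

lemma digits_sum:
  assumes "b \<ge> 2"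
  shows "(\<Sum>i<length (digits b n). digits b n ! i * b ^ i) = n"
  using assms
proof (induction b n rule: digits.induct)
  case (1 b n)
  show ?case
  proof (cases "n < b")
    case True
    then show ?thesis by (simp add: digits.simps)
  next
    case False
    let ?ds = "digits b (n div b)"
    have eq: "digits b n = (n mod b) # ?ds"
      using False 1(2) by (subst digits.simps) simp
    have IH: "(\<Sum>i<length ?ds. ?ds ! i * b ^ i) = n div b"
      using 1 False by simp
    have "(\<Sum>i<length ?ds. ?ds ! i * b ^ Suc i) = b * (\<Sum>i<length ?ds. ?ds ! i * b ^ i)"
      by (simp add: sum_distrib_left mult_ac)
    then show ?thesis
      unfolding eq using IH by (simp add: sum.lessThan_Suc_shift del: sum.lessThan_Suc power_Suc)
  qed
qed

lemma digits_less:
  assumes "b \<ge> 2" "d \<in> set (digits b n)"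
  shows "d < b"
  using assms
proof (induction b n rule: digits.induct)
  case (1 b n)
  then show ?case
    by (subst (asm) (2) digits.simps) (auto split: if_splits)
qed

lemma digits_not_Nil: "digits b n \<noteq> []"
  by (subst digits.simps) simp

lemma last_digits_pos:
  assumes "b \<ge> 2" "n > 0"
  shows "last (digits b n) > 0"
  using assms
proof (induction b n rule: digits.induct)
  case (1 b n)
  show ?case
  proof (cases "n < b")
    case True
    then show ?thesis using 1 by (simp add: digits.simps)
  next
    case False
    then have "n div b > 0" using 1 by (simp add: div_greater_zero_iff)
    then show ?thesis
      using 1 False by (subst digits.simps) (simp add: digits_not_Nil)
  qed
qed

lemma c0_ex1:
  "\<exists>!c::real. 0 < c \<and> c < 1 \<and> 2 * ln c + ln (c + 1) + c * ln (1 + 1 / c) = 1"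
proof -
  define f :: "real \<Rightarrow> real" where
    "f c = 2 * ln c + ln (c + 1) + c * ln (1 + 1 / c)" for c
  have der: "(f has_real_derivative (2 / c + ln (1 + 1 / c))) (at c)" if "c > 0" for c
  proof -
    have pos: "1 + 1 / c > 0" using that by (simp add: add_pos_pos)
    have "(f has_real_derivative
        (2 * (1 / c) + 1 / (c + 1) + (ln (1 + 1 / c) + c * ((- 1 / (c * c)) / (1 + 1 / c))))) (at c)"
      unfolding f_def using that pos
      by (auto intro!: derivative_eq_intros)
    moreover have "c * ((- 1 / (c * c)) / (1 + 1 / c)) = - (1 / (c + 1))"
      using that by (simp add: divide_simps)
    ultimately show ?thesis by simp
  qed
  have mono: "f x < f y" if "0 < x" "x < y" for x y
  proof (rule DERIV_pos_imp_increasing[OF that(2)])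
    fix z assume z: "x \<le> z" "z \<le> y"
    then have "z > 0" using that by simp
    moreover from this have "2 / z + ln (1 + 1 / z) > 0" by (simp add: add_pos_pos)
    ultimately show "\<exists>w. DERIV f z :> w \<and> w > 0" using der by blast
  qed
  have ln4: "2 * ln 2 > (1::real)"
  proof -
    have "exp 1 < (4::real)" using exp_le by simp
    then have "1 < ln (4::real)" using ln_exp[of 1] ln_less_cancel_iff[of "exp 1" 4] by simp
    also have "ln (4::real) = 2 * ln 2" using ln_realpow[of 2 2] by simp
    finally show ?thesis .
  qed
  have f1: "f 1 > 1" unfolding f_def using ln4 by simp
  have fh: "f (1/2) < 1"
  proof -
    have "ln (3/2) \<le> (3/2 - 1 :: real)" "ln 3 \<le> (3 - 1 :: real)"
      using ln_le_minus_one[of "3/2"] ln_le_minus_one[of 3] by simp_all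
    moreover have "f (1/2) = - 2 * ln 2 + ln (3/2) + 1/2 * ln 3"
      unfolding f_def by (simp add: ln_div)
    ultimately show ?thesis using ln4 by linarith
  qed
  have "\<exists>x\<ge>1/2. x \<le> 1 \<and> f x = 1"
  proof (rule IVT)
    show "\<forall>x. 1/2 \<le> x \<and> x \<le> 1 \<longrightarrow> isCont f x"
      by (auto intro!: DERIV_isCont[OF der])
  qed (use f1 fh in auto)
  then obtain x where x: "1/2 \<le> x" "x \<le> 1" "f x = 1" by blast
  moreover have "x \<noteq> 1" using x f1 by auto
  ultimately have "0 < x \<and> x < 1 \<and> f x = 1" by simp
  moreover have "y = x" if "0 < y \<and> y < 1 \<and> f y = 1" for y
    using mono[of x y] mono[of y x] that calculation by linarith
  ultimately show ?thesis unfolding f_def by blast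
qed

end

theory Submission
  imports Defs
begin

text \<open>Write \<open>S\<close> for \<open>sloane t b\<close>. If \<open>t \<ge> b\<close>, then \<open>S n \<ge> b ^ num_digits b n > n\<close>. Otherwise \<open>b - t\<close>
  is the only digit \<open>d\<close> for which \<open>b\<close> divides \<open>d + t\<close>, so \<open>S n = b ^ k * r\<close>, where \<open>k\<close> counts the
  digits \<open>b - t\<close> of \<open>n\<close> and all prime factors of \<open>r\<close> lie in a fixed finite set without \<open>b\<close>. By
  Conjecture B, \<open>r\<close> is equidistributed once it is long. When at most two thirds of the digits of
  \<open>b ^ k * r\<close> are trailing zeros, the logarithm of \<open>S (b ^ k * r) / b ^ num_digits b (b ^ k * r)\<close>
  is, up to a small error, at least \<open>num_digits b r\<close> times \<open>2 ln c\<close> plus the integral of \<open>ln\<close> over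
  \<open>[c, c + 1]\<close>, where \<open>c = (t - 1) / b\<close>. This is positive for \<open>c > c0\<close>, and as \<open>r\<close> has few digits
  \<open>b - t\<close>, the number \<open>S (b ^ k * r)\<close> again has few trailing zeros. When there are more trailing
  zeros, they become factors \<open>t\<close> coprime to \<open>b\<close>; since \<open>b \<le> t ^ 2\<close>, these give so many digits that
  one application of \<open>S\<close> leads back to the first case.\<close>

section \<open>Digits and the Sloane map\<close>

abbreviation num_digits :: "nat \<Rightarrow> nat \<Rightarrow> nat" where
  "num_digits b n \<equiv> length (digits b n)"

lemma less_num_digits_iff:
  assumes "b \<ge> 2" "n > 0"
  shows "j < num_digits b n \<longleftrightarrow> b ^ j \<le> n"
  using assms
proof (induction b n arbitrary: j rule: digits.induct)
  case (1 b n)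
  show ?case
  proof (cases j)
    case 0
    then show ?thesis using 1 by (simp add: digits_not_Nil)
  next
    case j: (Suc i)
    show ?thesis
    proof (cases "n < b")
      case True
      moreover have "b \<le> b ^ j" using 1 j by simp
      ultimately have "\<not> b ^ j \<le> n" by linarith
      then show ?thesis using True j by (simp add: digits.simps)
    next
      case False
      then have "n div b > 0" using 1 by (simp add: div_greater_zero_iff)
      then have "i < num_digits b (n div b) \<longleftrightarrow> b ^ i \<le> n div b" using 1 False by simp
      also have "\<dots> \<longleftrightarrow> b ^ j \<le> n"
        using 1 j by (simp add: less_eq_div_iff_mult_less_eq mult.commute)
      finally show ?thesis using 1 False j by (subst digits.simps) simp
    qed
  qed
qed

lemma less_power_num_digits:
  assumes "b \<ge> 2"
  shows "n < b ^ num_digits b n"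
  using less_num_digits_iff[OF assms, of n "num_digits b n"] assms by (cases "n = 0") auto

lemma digits_power_mult:
  assumes "b \<ge> 2" "r > 0"
  shows "digits b (b ^ k * r) = replicate k 0 @ digits b r"
proof (induction k)
  case (Suc k)
  have "b ^ Suc k * r \<ge> b" using assms by simp
  then have "digits b (b ^ Suc k * r) = 0 # digits b (b ^ k * r)"
    using assms by (subst digits.simps) simp
  then show ?case using Suc by simp
qed simp

lemma num_digits_power_mult:
  assumes "b \<ge> 2" "r > 0"
  shows "num_digits b (b ^ k * r) = k + num_digits b r"
  using assms by (simp add: digits_power_mult)

lemma count_digits_power_mult:
  assumes "b \<ge> 2" "r > 0" "d > 0"
  shows "count_list (digits b (b ^ k * r)) d = count_list (digits b r) d"
  using assms by (simp add: digits_power_mult)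

lemma prod_list_map_eq_power_count:
  fixes f :: "'a \<Rightarrow> 'b::comm_monoid_mult"
  shows "(\<Prod>x\<leftarrow>xs. f x) = f z ^ count_list xs z * (\<Prod>x\<leftarrow>filter (\<lambda>x. x \<noteq> z) xs. f x)"
  by (induction xs) (auto simp: mult_ac)

lemma power_le_sloane: "t ^ num_digits b n \<le> sloane t b n"
proof -
  have "t ^ length ds \<le> (\<Prod>d\<leftarrow>ds. d + t)" for ds :: "nat list"
    by (induction ds) (auto intro!: mult_mono)
  then show ?thesis by (simp add: sloane_def)
qed

section \<open>Logarithmic growth\<close>

definition log_ratio :: "nat \<Rightarrow> nat \<Rightarrow> nat \<Rightarrow> real" where
  "log_ratio t b d = ln (real (d + t) / real b)"

lemma sloane_eq_exp_sum_log_ratio: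
  assumes "t > 0" "b > 0"
  shows "real (sloane t b n) = real (b ^ num_digits b n) * exp (\<Sum>d\<leftarrow>digits b n. log_ratio t b d)"
proof -
  have "real (\<Prod>d\<leftarrow>ds. d + t) = real (b ^ length ds) * exp (\<Sum>d\<leftarrow>ds. log_ratio t b d)" for ds
  proof (induction ds)
    case (Cons d ds)
    have "real (d + t) = real b * exp (log_ratio t b d)"
      using assms by (simp add: log_ratio_def del: of_nat_add)
    then show ?case using Cons by (simp add: exp_add del: of_nat_add)
  qed simp
  then show ?thesis by (simp add: sloane_def)
qed

lemma power_num_digits_less_sloane_iff:
  assumes "t > 0" "b > 0"
  shows "b ^ num_digits b n < sloane t b n \<longleftrightarrow> 0 < (\<Sum>d\<leftarrow>digits b n. log_ratio t b d)"
proof -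
  have "b ^ num_digits b n < sloane t b n \<longleftrightarrow>
      real (b ^ num_digits b n) < real (b ^ num_digits b n) * exp (\<Sum>d\<leftarrow>digits b n. log_ratio t b d)"
    unfolding sloane_eq_exp_sum_log_ratio[OF assms, symmetric] by (rule of_nat_less_iff[symmetric])
  then show ?thesis using assms by simp
qed

text \<open>The term \<open>2 * log_ratio t b 0\<close> accounts for numbers \<open>b ^ k * r\<close> with \<open>k \<le> 2 * num_digits b r\<close>
  and \<open>r\<close> equidistributed.\<close>

definition log_growth :: "nat \<Rightarrow> nat \<Rightarrow> real" where
  "log_growth t b = 2 * log_ratio t b 0 + (\<Sum>d<b. log_ratio t b d) / real b"

definition limit_growth :: "real \<Rightarrow> real" where
  "limit_growth c = 2 * ln c + ((c + 1) * ln (c + 1) - c * ln c - 1)"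

lemma limit_growth_strict_mono:
  assumes "0 < x" "x < y"
  shows "limit_growth x < limit_growth y"
proof (rule DERIV_pos_imp_increasing[OF assms(2)])
  fix c assume "x \<le> c" "c \<le> y"
  then have c: "c > 0" using assms by simp
  then have "(limit_growth has_real_derivative 2 / c + (ln (c + 1) - ln c)) (at c)"
    unfolding limit_growth_def by (auto intro!: derivative_eq_intros)
  moreover have "2 / c + (ln (c + 1) - ln c) > 0" using c by (simp add: add_pos_pos)
  ultimately show "\<exists>w. (limit_growth has_real_derivative w) (at c) \<and> w > 0" by blast
qed

lemma c0_pos: "0 < c0"
  and limit_growth_c0: "limit_growth c0 = 0"
proof -
  have c0: "0 < c0" "2 * ln c0 + ln (c0 + 1) + c0 * ln (1 + 1 / c0) = 1"
    using theI'[OF c0_ex1] unfolding c0_def by auto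
  then show "0 < c0" by simp
  have "1 + 1 / c0 = (c0 + 1) / c0" using c0 by (simp add: field_simps)
  then have ln_eq: "ln (1 + 1 / c0) = ln (c0 + 1) - ln c0" using c0 by (simp add: ln_div)
  show "limit_growth c0 = 0"
    using c0(2) unfolding ln_eq by (simp add: limit_growth_def algebra_simps)
qed

lemma right_riemann_sum_ge:
  fixes F f :: "real \<Rightarrow> real"
  assumes "h > 0"
    and deriv: "\<And>y. a \<le> y \<Longrightarrow> y \<le> a + real n * h \<Longrightarrow> (F has_real_derivative f y) (at y)"
    and mono: "mono_on {a..a + real n * h} f"
  shows "F (a + real n * h) - F a \<le> (\<Sum>i<n. f (a + real (Suc i) * h)) * h"
proof -
  let ?p = "\<lambda>i. a + real i * h"
  have "F (a + real n * h) - F a = (\<Sum>i<n. F (?p (Suc i)) - F (?p i))"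
    using sum_lessThan_telescope[of "\<lambda>i. F (?p i)" n] by simp
  also have "\<dots> \<le> (\<Sum>i<n. f (?p (Suc i)) * h)"
  proof (rule sum_mono)
    fix i assume "i \<in> {..<n}"
    then have "real (Suc i) * h \<le> real n * h" using assms(1) by (intro mult_right_mono) auto
    then have p: "a \<le> ?p i" "?p i < ?p (Suc i)" "?p (Suc i) \<le> a + real n * h"
      using assms(1) by (simp_all add: algebra_simps)
    then have "\<exists>z. ?p i < z \<and> z < ?p (Suc i) \<and>
        F (?p (Suc i)) - F (?p i) = (?p (Suc i) - ?p i) * f z"
      by (intro MVT2 deriv) auto
    then obtain z where z: "?p i < z" "z < ?p (Suc i)"
        "F (?p (Suc i)) - F (?p i) = (?p (Suc i) - ?p i) * f z"
      by blast
    moreover have "f z \<le> f (?p (Suc i))" using z p by (intro mono_onD[OF mono]) auto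
    moreover have "?p (Suc i) - ?p i = h" by (simp add: algebra_simps)
    ultimately show "F (?p (Suc i)) - F (?p i) \<le> f (?p (Suc i)) * h"
      using assms(1) by (simp add: mult.commute)
  qed
  finally show ?thesis by (simp add: sum_distrib_right)
qed

lemma limit_growth_le_log_growth:
  assumes "t > 1" "b > 0"
  shows "limit_growth ((real t - 1) / real b) \<le> log_growth t b"
proof -
  define y where "y = (real t - 1) / real b"
  have y: "y > 0" "y \<le> real t / real b" using assms by (simp_all add: y_def divide_right_mono)
  let ?F = "\<lambda>u. u * ln u - u"
  have "?F (y + real b * (1 / real b)) - ?F y
      \<le> (\<Sum>d<b. ln (y + real (Suc d) * (1 / real b))) * (1 / real b)"
  proof (rule right_riemann_sum_ge)
    show "(?F has_real_derivative ln u) (at u)" if "y \<le> u" for u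
      using that y by (auto intro!: derivative_eq_intros)
    show "mono_on {y..y + real b * (1 / real b)} ln"
      using y by (intro mono_onI) auto
  qed (use assms in auto)
  also have "(\<lambda>d. ln (y + real (Suc d) * (1 / real b))) = log_ratio t b"
    by (auto simp: log_ratio_def y_def add.commute simp flip: add_divide_distrib)
  finally have "?F (y + 1) - ?F y \<le> (\<Sum>d<b. log_ratio t b d) / real b" using assms by simp
  moreover have "ln y \<le> log_ratio t b 0" using y by (simp add: log_ratio_def)
  ultimately show ?thesis
    unfolding y_def[symmetric] limit_growth_def log_growth_def by (simp add: algebra_simps)
qed

lemma log_growth_pos_if_c0_less:
  assumes "b > 0" "c0 * real b < real t - 1"
  shows "log_growth t b > 0"
proof -
  have "c0 * real b > 0" using assms c0_pos by simp
  then have "t > 1" using assms by linarith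
  have "c0 < (real t - 1) / real b" using assms by (simp add: field_simps)
  then have "0 < limit_growth ((real t - 1) / real b)"
    using limit_growth_strict_mono[OF c0_pos] by (simp add: limit_growth_c0)
  also have "\<dots> \<le> log_growth t b" using \<open>t > 1\<close> assms(1) by (rule limit_growth_le_log_growth)
  finally show ?thesis .
qed

section \<open>Equidistribution\<close>

lemma sum_list_map_eq_sum_of_nat_count:
  fixes f :: "'a \<Rightarrow> 'b::semiring_1"
  assumes "set xs \<subseteq> A" "finite A"
  shows "(\<Sum>x\<leftarrow>xs. f x) = (\<Sum>x\<in>A. of_nat (count_list xs x) * f x)"
  using assms(1)
proof (induction xs)
  case (Cons y xs)
  have "(\<Sum>x\<in>A. of_nat (count_list (y # xs) x) * f x) =
      (\<Sum>x\<in>A. of_nat (count_list xs x) * f x + (if x = y then f x else 0))"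
    by (intro sum.cong) (auto simp: algebra_simps)
  then show ?case using Cons assms(2) by (simp add: sum.distrib add.commute)
qed simp

lemma equidistributed_mean:
  assumes "q \<ge> 2" "equidistributed \<epsilon> q n"
  shows "\<bar>(\<Sum>d\<leftarrow>digits q n. f d) / real (num_digits q n) - (\<Sum>d<q. f d) / real q\<bar>
    \<le> \<epsilon> * (\<Sum>d<q. \<bar>f d\<bar>)"
proof -
  let ?freq = "\<lambda>d. real (count_list (digits q n) d) / real (num_digits q n)"
  have "set (digits q n) \<subseteq> {..<q}" using digits_less[OF assms(1)] by auto
  then have "(\<Sum>d\<leftarrow>digits q n. f d) / real (num_digits q n) - (\<Sum>d<q. f d) / real q =
      (\<Sum>d<q. (?freq d - 1 / real q) * f d)"
    by (simp add: sum_list_map_eq_sum_of_nat_count sum_divide_distrib sum_subtractf left_diff_distrib)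
  also have "\<bar>\<dots>\<bar> \<le> (\<Sum>d<q. \<bar>?freq d - 1 / real q\<bar> * \<bar>f d\<bar>)"
    by (rule order_trans[OF sum_abs]) (simp add: abs_mult)
  also have "\<dots> \<le> (\<Sum>d<q. \<epsilon> * \<bar>f d\<bar>)"
    using assms(2) unfolding equidistributed_def
    by (intro sum_mono mult_right_mono) (auto intro: less_imp_le)
  finally show ?thesis by (simp add: sum_distrib_left)
qed

lemma equidistributed_count_less:
  assumes "equidistributed \<epsilon> q n" "d < q"
  shows "real (count_list (digits q n) d) < (1 / real q + \<epsilon>) * real (num_digits q n)"
proof -
  have "\<bar>real (count_list (digits q n) d) / real (num_digits q n) - 1 / real q\<bar> < \<epsilon>"
    using assms unfolding equidistributed_def by blast
  then have "real (count_list (digits q n) d) / real (num_digits q n) < 1 / real q + \<epsilon>"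
    by linarith
  then show ?thesis by (simp add: digits_not_Nil pos_divide_less_eq)
qed

definition supported_on :: "nat set \<Rightarrow> nat \<Rightarrow> bool" where
  "supported_on F r \<longleftrightarrow> r > 0 \<and> prime_factors r \<subseteq> F"

lemma supported_on_prod_list:
  assumes "\<And>x. x \<in> set xs \<Longrightarrow> supported_on F x"
  shows "supported_on F (prod_list xs)"
  using assms by (induction xs) (auto simp: supported_on_def prime_factors_product)

lemma supported_on_eq_prod:
  assumes "finite F" "\<And>p. p \<in> F \<Longrightarrow> prime p" "supported_on F r"
  shows "r = (\<Prod>p\<in>F. p ^ multiplicity p r)"
proof -
  have "r = (\<Prod>p\<in>prime_factors r. p ^ multiplicity p r)"
    using assms(3) by (simp add: supported_on_def prod_prime_factors)
  also have "\<dots> = (\<Prod>p\<in>F. p ^ multiplicity p r)"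
    using assms by (intro prod.mono_neutral_left)
      (auto simp: supported_on_def in_prime_factors_iff not_dvd_imp_multiplicity_0)
  finally show ?thesis .
qed

lemma conjecture_B_supported_on:
  assumes conj_B: "conjecture_B"
    and F: "finite F" "\<And>p. p \<in> F \<Longrightarrow> prime p" "\<not> {p. prime p \<and> p dvd q} \<subseteq> F"
    and q: "q \<ge> 2" and \<epsilon>: "\<epsilon> > 0"
  obtains R where "\<And>r. supported_on F r \<Longrightarrow> R < num_digits q r \<Longrightarrow> equidistributed \<epsilon> q r"
proof -
  have "q > 1 \<and> finite F \<and> (\<forall>p\<in>F. prime p) \<and> \<not> {p. prime p \<and> p dvd q} \<subseteq> F \<and> (1::nat) > 0 \<and> \<epsilon> > 0"
    using F q \<epsilon> by simp
  from conj_B[unfolded conjecture_B_def, rule_format, OF this]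
  obtain N where N: "\<And>\<alpha>. \<exists>p\<in>F. \<alpha> p \<ge> N \<Longrightarrow> equidistributed \<epsilon> q (1 * (\<Prod>p\<in>F. p ^ \<alpha> p))"
    by blast
  define R where "R = (\<Prod>p\<in>F. p ^ N)"
  have "equidistributed \<epsilon> q r" if r: "supported_on F r" "R < num_digits q r" for r
  proof -
    have eq: "r = (\<Prod>p\<in>F. p ^ multiplicity p r)" using F(1,2) r(1) by (rule supported_on_eq_prod)
    have "R < q ^ R" using q by (intro power_gt_expt) simp
    also have "\<dots> \<le> r" using r q by (simp add: supported_on_def less_num_digits_iff)
    finally have "R < r" .
    have "\<exists>p\<in>F. multiplicity p r \<ge> N"
    proof (rule ccontr)
      assume "\<not> ?thesis"
      then have "(\<Prod>p\<in>F. p ^ multiplicity p r) \<le> R"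
        unfolding R_def using F(2)
        by (intro prod_mono) (auto simp: prime_gt_0_nat intro!: power_increasing Suc_leI)
      then show False using eq \<open>R < r\<close> by simp
    qed
    then show ?thesis using N[of "\<lambda>p. multiplicity p r"] eq by simp
  qed
  then show ?thesis by (rule that)
qed

lemma power_num_digits_less_sloane_if_equidistributed:
  assumes b: "b \<ge> 2" and t: "0 < t" "t \<le> b" and r: "r > 0" "k \<le> 2 * num_digits b r"
    and eq: "equidistributed \<epsilon> b r" and \<epsilon>: "\<epsilon> * (\<Sum>d<b. \<bar>log_ratio t b d\<bar>) < log_growth t b"
  shows "b ^ num_digits b (b ^ k * r) < sloane t b (b ^ k * r)"
proof -
  define L where "L = real (num_digits b r)"
  define M where "M = (\<Sum>d\<leftarrow>digits b r. log_ratio t b d) / L"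
  have L: "L > 0" by (simp add: L_def digits_not_Nil)
  have "log_ratio t b 0 \<le> 0" using b t by (simp add: log_ratio_def)
  then have zeros: "real k * log_ratio t b 0 \<ge> 2 * L * log_ratio t b 0"
    using r(2) by (intro mult_right_mono_neg) (auto simp: L_def)
  have "\<bar>M - (\<Sum>d<b. log_ratio t b d) / real b\<bar> \<le> \<epsilon> * (\<Sum>d<b. \<bar>log_ratio t b d\<bar>)"
    unfolding M_def L_def using b eq by (rule equidistributed_mean)
  then have "0 < 2 * log_ratio t b 0 + M" using \<epsilon> unfolding log_growth_def by linarith
  then have "0 < L * (2 * log_ratio t b 0 + M)" using L by simp
  also have "\<dots> \<le> real k * log_ratio t b 0 + L * M" using zeros by (simp add: algebra_simps)
  also have "\<dots> = (\<Sum>d\<leftarrow>digits b (b ^ k * r). log_ratio t b d)"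
    using b r L by (simp add: digits_power_mult sum_list_replicate M_def)
  finally show ?thesis using b t by (subst power_num_digits_less_sloane_iff) auto
qed

section \<open>Iteration\<close>

lemma filterlim_funpow_at_top:
  fixes f :: "nat \<Rightarrow> nat"
  assumes "\<And>x. P x \<Longrightarrow> x < f x \<and> P (f x)" and "P ((f ^^ j) n)"
  shows "filterlim (\<lambda>k. (f ^^ k) n) at_top sequentially"
proof -
  have P: "P ((f ^^ (k + j)) n)" for k
    using assms by (induction k) auto
  have "strict_mono (\<lambda>k. (f ^^ (k + j)) n)"
    using assms(1)[OF P] by (simp add: strict_mono_Suc_iff)
  then have "filterlim (\<lambda>k. (f ^^ (k + j)) n) at_top sequentially"
    by (rule filterlim_subseq)
  then show ?thesis
    unfolding filterlim_at_top using eventually_sequentially_seg[of _ j] by blast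
qed

lemma sloane_iterates_diverge_if_base_le_shift:
  assumes "b \<ge> 2" "b \<le> t"
  shows "filterlim (\<lambda>k. (sloane t b ^^ k) n) at_top sequentially"
proof (rule filterlim_funpow_at_top)
  fix m
  have "m < b ^ num_digits b m" using assms(1) by (rule less_power_num_digits)
  also have "\<dots> \<le> t ^ num_digits b m" using assms(2) by (intro power_mono) auto
  also have "\<dots> \<le> sloane t b m" by (rule power_le_sloane)
  finally show "m < sloane t b m \<and> True" by simp
qed simp

locale expanding_shift =
  fixes b t :: nat
  assumes prime_b: "prime b" and t_pos: "0 < t" and t_less: "t < b"
    and log_growth_pos: "log_growth t b > 0"
begin

lemma b_ge_2: "b \<ge> 2"
  using prime_b by (rule prime_ge_2_nat)

lemma base_le_shift_square: "b \<le> t ^ 2"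
proof -
  have b: "real b > 0" using b_ge_2 by simp
  have "log_ratio t b d \<le> ln 2" if "d < b" for d
    using that t_pos t_less b by (simp add: log_ratio_def field_simps)
  then have "(\<Sum>d<b. log_ratio t b d) / real b \<le> ln 2"
    using b sum_bounded_above[of "{..<b}" "log_ratio t b" "ln 2"] by (simp add: field_simps)
  then have "0 < 2 * log_ratio t b 0 + ln 2" using log_growth_pos by (simp add: log_growth_def)
  also have "\<dots> = ln ((real t / real b) ^ 2 * 2)"
    using b t_pos by (simp add: log_ratio_def ln_mult ln_realpow)
  finally have "1 < (real t / real b) ^ 2 * 2" using b t_pos by simp
  then have "real (b ^ 2) < real (2 * t ^ 2)" using b by (simp add: field_simps)
  then have "b ^ 2 < 2 * t ^ 2" by (simp only: of_nat_less_iff)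
  moreover have "2 * b \<le> b ^ 2" using b_ge_2 by (simp add: power2_eq_square)
  ultimately show ?thesis by linarith
qed

lemma num_digits_less_sloane: "num_digits b n < 2 * num_digits b (sloane t b n)"
proof -
  have "b ^ num_digits b n \<le> (t ^ num_digits b n) ^ 2"
    using power_mono[OF base_le_shift_square, of "num_digits b n"]
    by (simp add: mult.commute flip: power_mult)
  also have "\<dots> \<le> sloane t b n ^ 2" using power_le_sloane by (intro power_mono) auto
  also have "\<dots> < (b ^ num_digits b (sloane t b n)) ^ 2"
    using less_power_num_digits[OF b_ge_2] by (intro power_strict_mono) auto
  finally have "b ^ num_digits b n < b ^ (2 * num_digits b (sloane t b n))"
    by (simp add: mult.commute flip: power_mult)
  then show ?thesis using b_ge_2 by (simp add: power_strict_increasing_iff)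
qed

definition cofactor_primes :: "nat set" where
  "cofactor_primes = {p. prime p \<and> p < 2 * b} - {b}"

definition cofactor :: "nat \<Rightarrow> nat" where
  "cofactor n = (\<Prod>d\<leftarrow>filter (\<lambda>d. d \<noteq> b - t) (digits b n). d + t)"

lemma sloane_eq_power_mult_cofactor:
  "sloane t b n = b ^ count_list (digits b n) (b - t) * cofactor n"
  using prod_list_map_eq_power_count[of "\<lambda>d. d + t" "digits b n" "b - t"] t_less
  by (simp add: sloane_def cofactor_def)

lemma base_dvd_add_shift_iff:
  assumes "d < b"
  shows "b dvd d + t \<longleftrightarrow> d = b - t"
proof
  assume "b dvd d + t"
  then obtain j where j: "d + t = b * j" by blast
  then have "b * j < b * 2" "b * j > 0" using assms t_less t_pos by linarith+
  then have "j = 1" by simp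
  then show "d = b - t" using j by simp
qed (use t_less in simp)

lemma supported_on_cofactor: "supported_on cofactor_primes (cofactor n)"
  unfolding cofactor_def
proof (rule supported_on_prod_list)
  fix x assume "x \<in> set (map (\<lambda>d. d + t) (filter (\<lambda>d. d \<noteq> b - t) (digits b n)))"
  then obtain d where d: "x = d + t" "d < b" "d \<noteq> b - t" using digits_less[OF b_ge_2] by auto
  then have "\<not> b dvd x" by (simp add: base_dvd_add_shift_iff)
  moreover have "p < 2 * b" if "p dvd x" for p using dvd_imp_le[OF that] d t_pos t_less by simp
  ultimately show "supported_on cofactor_primes x"
    using d t_pos by (auto simp: supported_on_def cofactor_primes_def in_prime_factors_iff)
qed

lemma num_digits_sloane:
  "num_digits b (sloane t b n) = count_list (digits b n) (b - t) + num_digits b (cofactor n)"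
  using supported_on_cofactor[of n] b_ge_2
  by (simp add: sloane_eq_power_mult_cofactor num_digits_power_mult supported_on_def)

definition few_trailing_zeros :: "nat \<Rightarrow> bool" where
  "few_trailing_zeros n \<longleftrightarrow>
     (\<exists>k r. n = b ^ k * r \<and> supported_on cofactor_primes r \<and> k \<le> 2 * num_digits b r)"

lemma few_trailing_zeros_sloane:
  assumes "3 * count_list (digits b n) (b - t) \<le> 2 * num_digits b (sloane t b n)"
  shows "few_trailing_zeros (sloane t b n)"
  unfolding few_trailing_zeros_def
proof (intro exI conjI)
  show "count_list (digits b n) (b - t) \<le> 2 * num_digits b (cofactor n)"
    using assms num_digits_sloane[of n] by linarith
qed (rule sloane_eq_power_mult_cofactor supported_on_cofactor)+

lemma few_trailing_zeros_sloane_sloane: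
  assumes "\<not> few_trailing_zeros (sloane t b m)"
  shows "few_trailing_zeros (sloane t b (sloane t b m))"
proof (rule few_trailing_zeros_sloane)
  have "count_list (digits b (sloane t b m)) (b - t) = count_list (digits b (cofactor m)) (b - t)"
    using supported_on_cofactor[of m] b_ge_2 t_less
    by (simp add: sloane_eq_power_mult_cofactor count_digits_power_mult supported_on_def)
  also have "\<dots> \<le> num_digits b (cofactor m)" by (rule count_le_length)
  finally show "3 * count_list (digits b (sloane t b m)) (b - t)
      \<le> 2 * num_digits b (sloane t b (sloane t b m))"
    using assms few_trailing_zeros_sloane[of m] num_digits_sloane[of m]
      num_digits_less_sloane[of "sloane t b m"] by linarith
qed

lemma count_base_minus_shift_le:
  assumes "equidistributed \<epsilon> b r" "\<epsilon> \<le> 1 / 6"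
  shows "3 * count_list (digits b r) (b - t) \<le> 2 * num_digits b r"
proof -
  have "1 / real b + \<epsilon> \<le> 1 / 2 + 1 / 6"
    using b_ge_2 assms(2) by (intro add_mono) (auto simp: field_simps)
  then have freq: "1 / real b + \<epsilon> \<le> 2 / 3" by simp
  have "real (count_list (digits b r) (b - t)) < (1 / real b + \<epsilon>) * real (num_digits b r)"
    using assms(1) t_pos b_ge_2 by (intro equidistributed_count_less) auto
  also have "\<dots> \<le> 2 / 3 * real (num_digits b r)" using freq by (rule mult_right_mono) simp
  finally show ?thesis by linarith
qed

lemma few_trailing_zeros_step:
  assumes R: "\<And>r. supported_on cofactor_primes r \<Longrightarrow> R < num_digits b r \<Longrightarrow> equidistributed \<epsilon> b r"
    and \<epsilon>: "\<epsilon> \<le> 1 / 6" "\<epsilon> * (\<Sum>d<b. \<bar>log_ratio t b d\<bar>) < log_growth t b"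
    and n: "few_trailing_zeros n" "3 * R < num_digits b n"
  shows "n < sloane t b n"
    and "num_digits b n < num_digits b (sloane t b n)"
    and "few_trailing_zeros (sloane t b n)"
proof -
  obtain k r where r: "n = b ^ k * r" "supported_on cofactor_primes r" "k \<le> 2 * num_digits b r"
    using n(1) unfolding few_trailing_zeros_def by blast
  then have "r > 0" by (simp add: supported_on_def)
  then have len: "num_digits b n = k + num_digits b r"
    using r b_ge_2 by (simp add: num_digits_power_mult)
  then have eq: "equidistributed \<epsilon> b r" using r n(2) by (intro R) auto
  have less: "b ^ num_digits b n < sloane t b n"
    unfolding r(1) using b_ge_2 t_pos less_imp_le[OF t_less] \<open>r > 0\<close> r(3) eq \<epsilon>(2)
    by (rule power_num_digits_less_sloane_if_equidistributed)
  then show "n < sloane t b n" using less_power_num_digits[OF b_ge_2, of n] by linarith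
  show longer: "num_digits b n < num_digits b (sloane t b n)"
    using less b_ge_2 by (subst less_num_digits_iff) auto
  have "count_list (digits b n) (b - t) = count_list (digits b r) (b - t)"
    using r(1) \<open>r > 0\<close> b_ge_2 t_less by (simp add: count_digits_power_mult)
  then show "few_trailing_zeros (sloane t b n)"
    using longer len count_base_minus_shift_le[OF eq \<epsilon>(1)]
    by (intro few_trailing_zeros_sloane) linarith
qed

lemma small_equidistribution_error:
  obtains \<epsilon> where "\<epsilon> > 0" "\<epsilon> \<le> 1 / 6" "\<epsilon> * (\<Sum>d<b. \<bar>log_ratio t b d\<bar>) < log_growth t b"
proof -
  define A where "A = (\<Sum>d<b. \<bar>log_ratio t b d\<bar>)"
  define \<epsilon> where "\<epsilon> = min (1 / 6) (log_growth t b / (A + 1))"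
  have A: "A \<ge> 0" unfolding A_def by (rule sum_nonneg) simp
  then have "\<epsilon> > 0" using log_growth_pos by (simp add: \<epsilon>_def)
  then have "\<epsilon> * A < \<epsilon> * (A + 1)" by simp
  also have "\<dots> \<le> log_growth t b / (A + 1) * (A + 1)"
    using A by (intro mult_right_mono) (auto simp: \<epsilon>_def)
  also have "\<dots> = log_growth t b" using A by simp
  finally have "\<epsilon> * A < log_growth t b" .
  moreover have "\<epsilon> \<le> 1 / 6" unfolding \<epsilon>_def by (rule min.cobounded1)
  ultimately show ?thesis using that[of \<epsilon>] \<open>\<epsilon> > 0\<close> by (simp add: A_def)
qed

theorem sloane_iterates_diverge:
  assumes "conjecture_B"
  shows "\<forall>\<^sub>F n in sequentially. filterlim (\<lambda>k. (sloane t b ^^ k) n) at_top sequentially"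
proof -
  obtain \<epsilon> where \<epsilon>: "\<epsilon> > 0" "\<epsilon> \<le> 1 / 6" "\<epsilon> * (\<Sum>d<b. \<bar>log_ratio t b d\<bar>) < log_growth t b"
    by (rule small_equidistribution_error)
  have primes: "finite cofactor_primes" "\<And>p. p \<in> cofactor_primes \<Longrightarrow> prime p"
      "\<not> {p. prime p \<and> p dvd b} \<subseteq> cofactor_primes"
    using prime_b by (auto simp: cofactor_primes_def)
  obtain R where R:
      "\<And>r. supported_on cofactor_primes r \<Longrightarrow> R < num_digits b r \<Longrightarrow> equidistributed \<epsilon> b r"
    using conjecture_B_supported_on[OF assms primes b_ge_2 \<epsilon>(1)] by blast
  let ?P = "\<lambda>n. few_trailing_zeros n \<and> 3 * R < num_digits b n"
  have step: "m < sloane t b m \<and> ?P (sloane t b m)" if "?P m" for m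
    using few_trailing_zeros_step[OF R \<epsilon>(2,3) conjunct1[OF that] conjunct2[OF that]] that by auto
  have "filterlim (\<lambda>k. (sloane t b ^^ k) n) at_top sequentially" if n: "n \<ge> b ^ (12 * R)" for n
  proof -
    have "n > 0" using n b_ge_2 by (metis gr_zeroI le_zero_eq power_not_zero not_numeral_le_zero)
    then have "12 * R < num_digits b n" using n b_ge_2 by (simp add: less_num_digits_iff)
    then have "3 * R < num_digits b (sloane t b n)" "3 * R < num_digits b (sloane t b (sloane t b n))"
      using num_digits_less_sloane[of n] num_digits_less_sloane[of "sloane t b n"] by linarith+
    then have "?P ((sloane t b ^^ 1) n) \<or> ?P ((sloane t b ^^ Suc 1) n)"
      using few_trailing_zeros_sloane_sloane by auto
    then show ?thesis using filterlim_funpow_at_top[of ?P, OF step] by blast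
  qed
  then show ?thesis unfolding eventually_sequentially by blast
qed

end

theorem sloane_iterates_diverge_if_c0_less:
  assumes "conjecture_B" "prime b" "c0 * real b < real t - 1"
  shows "\<forall>\<^sub>F n in sequentially. filterlim (\<lambda>k. (sloane t b ^^ k) n) at_top sequentially"
proof (cases "b \<le> t")
  case True
  then show ?thesis
    using sloane_iterates_diverge_if_base_le_shift prime_ge_2_nat[OF assms(2)] by simp
next
  case False
  have "b > 0" using assms(2) by (rule prime_gt_0_nat)
  then have "c0 * real b > 0" using c0_pos by simp
  then have "t > 0" using assms(3) by linarith
  moreover have "log_growth t b > 0" using \<open>b > 0\<close> assms(3) by (rule log_growth_pos_if_c0_less)
  ultimately interpret expanding_shift b t using assms(2) False by unfold_locales auto
  show ?thesis using assms(1) by (rule sloane_iterates_diverge)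
qed

theorem theorem23:
  assumes "conjecture_B"
  shows "\<forall>c::real. c > c0 \<longrightarrow>
    (\<exists>b0::nat. \<forall>b::nat. prime b \<and> b \<ge> b0 \<longrightarrow>
      (\<forall>t::nat. t > 0 \<and> real t \<ge> c * real b \<longrightarrow>
        (\<exists>n0::nat. \<forall>n\<ge>n0. filterlim (\<lambda>k. (sloane t b ^^ k) n) at_top sequentially)))"
proof (intro allI impI)
  fix c :: real assume c: "c > c0"
  obtain b0 :: nat where b0: "1 / (c - c0) < real b0" using reals_Archimedean2 by blast
  have "\<forall>\<^sub>F n in sequentially. filterlim (\<lambda>k. (sloane t b ^^ k) n) at_top sequentially"
    if "prime b" "b \<ge> b0" "real t \<ge> c * real b" for b t :: nat
  proof -
    have "1 / (c - c0) < real b" using that(2) b0 by linarith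
    then have "c0 * real b < real t - 1" using c that(3) by (simp add: field_simps)
    with assms that(1) show ?thesis by (rule sloane_iterates_diverge_if_c0_less)
  qed
  then show "\<exists>b0. \<forall>b. prime b \<and> b \<ge> b0 \<longrightarrow> (\<forall>t. t > 0 \<and> real t \<ge> c * real b \<longrightarrow>
      (\<exists>n0. \<forall>n\<ge>n0. filterlim (\<lambda>k. (sloane t b ^^ k) n) at_top sequentially))"
    unfolding eventually_sequentially by blast
qed

end
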